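(* Let $\mathscr{C}=\mathrm{Top}_{mtr}$ be the category of metrizable topological spaces and continuous maps, $A=\mathbb{R}_{\ge0}$ with the Euclidean topology, $F=\{(x,y)\in\mathbb{R}^2\mid 0\le x,\ 0\le y\le x\}$ with the subspace topology, $p:F\to A$, $p(x,y)=x$, and $1_F=(1,1)\in F$. For continuous $x:U\to\mathbb{R}_{\ge0}$ identify $\llbracket x\rrbracket$ with $\{(u,a)\in U\times\mathbb{R}_{\ge0}\mid 0\le a\le x(u)\}$ and, for continuous $f:\llbracket x\rrbracket\to\mathbb{R}_{\ge0}$, identify $\llbracket f\rrbracket$ with $\{(u,a,b)\mid (u,a)\in\llbracket x\rrbracket,\ 0\le b\le f(u,a)\}$ (subspace topology), and define $$\Big(\sum^{x}f\Big)(u)=\int_0^{x(u)}f(u,t)\,dt,\qquad f^\flat:\llbracket f\rrbracket\to\Big\llbracket\sum^x f\Big\rrbracket,\quad f^\flat(u,a,b)=\Big(u,\int_0^{a}f(u,t)\,dt\Big).$$ Then these data make $\mathbb{R}_{\ge0}$ into a commutative dependent adder in $\mathrm{Top}_{mtr}$.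
   Context: Let $\mathscr{C}$ be a category with finite limits and terminal object $*$. A dependent adder in $\mathscr{C}$ consists of: (1) an object $A$; (2) a morphism $p:F\to A$; for $x:U\to A$ write $\llbracket x\rrbracket=U\times_A F$ (pullback of $x$ and $p$) and $p_x:\llbracket x\rrbracket\to U$ for the projection; (3) a morphism $1_F:*\to F$; put $1_A=p\circ 1_F$; (4) for every $x:U\to A$ a function $\sum^{x}:\mathrm{Hom}(\llbracket x\rrbracket,A)\to\mathrm{Hom}(U,A)$, natural in the sense that for $h:U\to U'$ and $y:U'\to A$ with $y\circ h=x$ one has $\sum^{x}(g\circ(h\times_A \mathrm{id}_F))=(\sum^{y}g)\circ h$ for all $g:\llbracket y\rrbracket\to A$; (5) for every $x:U\to A$ and $f:\llbracket x\rrbracket\to A$ a morphism $f^\flat:\llbracket f\rrbracket\to\llbracket\sum^{x}f\rrbracket$ with $p_{\sum^x f}\circ f^\flat=p_x\circ p_f$. The axioms are, for all $x:U\to A$, $f:\llbracket x\rrbracket\to A$, $g:\llbracket\sum^x f\rrbracket\to A$, writing $const_{1_A}:\llbracket x\rrbracket\to *\to A$ for the constant $1_A$ map: (Right Unit) $\sum^{x}const_{1_A}=x$; (Left Unit) $\sum^{const_{1_A}}(f\circ const_{1_A}^\flat)=f$; (Sum Associativity) $\sum^{\sum^x f}g=\sum^x\sum^f(g\circ f^\flat)$; (Flatten Associativity) $g^\flat\circ(f^\flat\times_A\mathrm{id}_F)=\big(\sum^f(g\circ f^\flat)\big)^\flat\circ(g\circ f^\flat)^\flat$ as morphisms $\llbracket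 g\circ f^\flat\rrbracket\to\llbracket\sum^x\sum^f(g\circ f^\flat)\rrbracket$. It is commutative if for all $x,y:U\to A$ and $f:\llbracket x\circ p_y\rrbracket\to A$ one has $\sum^{y}\sum^{x\circ p_y}f=\sum^{x}\sum^{y\circ p_x}(f\circ switch)$, where $switch$ is the canonical isomorphism between $\llbracket y\circ p_x\rrbracket$ and $\llbracket x\circ p_y\rrbracket$ (interchanging the two factors $F$). *)

theory Defs
  imports "HOL-Analysis.Analysis"
begin

section \<open>Categories, pullbacks and finite limits\<close>

record ('o, 'm) cat =
  Obj :: "'o set"
  Arr :: "'m set"
  Dom :: "'m \<Rightarrow> 'o"
  Cod :: "'m \<Rightarrow> 'o"
  Ide :: "'o \<Rightarrow> 'm"
  Comp :: "'m \<Rightarrow> 'm \<Rightarrow> 'm"  (infixr "\<odot>\<index>" 70)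

definition Hom :: "('o, 'm) cat \<Rightarrow> 'o \<Rightarrow> 'o \<Rightarrow> 'm set" where
  "Hom C X Y = {f \<in> Arr C. Dom C f = X \<and> Cod C f = Y}"

locale category =
  fixes C :: "('o, 'm) cat" (structure)
  assumes dom_obj: "f \<in> Arr C \<Longrightarrow> Dom C f \<in> Obj C"
    and cod_obj: "f \<in> Arr C \<Longrightarrow> Cod C f \<in> Obj C"
    and ide_hom: "X \<in> Obj C \<Longrightarrow> Ide C X \<in> Hom C X X"
    and comp_hom: "\<lbrakk>f \<in> Hom C X Y; g \<in> Hom C Y Z\<rbrakk> \<Longrightarrow> g \<odot> f \<in> Hom C X Z"
    and comp_ide_right: "f \<in> Hom C X Y \<Longrightarrow> f \<odot> Ide C X = f"
    and comp_ide_left: "f \<in> Hom C X Y \<Longrightarrow> Ide C Y \<odot> f = f"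
    and comp_assoc: "\<lbrakk>f \<in> Hom C W X; g \<in> Hom C X Y; h \<in> Hom C Y Z\<rbrakk>
      \<Longrightarrow> (h \<odot> g) \<odot> f = h \<odot> (g \<odot> f)"

definition is_functor ::
  "('i, 'k) cat \<Rightarrow> ('o, 'm) cat \<Rightarrow> ('i \<Rightarrow> 'o) \<Rightarrow> ('k \<Rightarrow> 'm) \<Rightarrow> bool" where
  "is_functor J C Fo Fa \<longleftrightarrow>
     (\<forall>i \<in> Obj J. Fo i \<in> Obj C) \<and>
     (\<forall>k \<in> Arr J. Fa k \<in> Hom C (Fo (Dom J k)) (Fo (Cod J k))) \<and>
     (\<forall>i \<in> Obj J. Fa (Ide J i) = Ide C (Fo i)) \<and>
     (\<forall>k \<in> Arr J. \<forall>l \<in> Arr J. Cod J k = Dom J l \<longrightarrow>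
        Fa (Comp J l k) = Comp C (Fa l) (Fa k))"

definition is_cone ::
  "('i, 'k) cat \<Rightarrow> ('o, 'm) cat \<Rightarrow> ('i \<Rightarrow> 'o) \<Rightarrow> ('k \<Rightarrow> 'm) \<Rightarrow> 'o \<Rightarrow> ('i \<Rightarrow> 'm) \<Rightarrow> bool" where
  "is_cone J C Fo Fa L \<pi> \<longleftrightarrow>
     L \<in> Obj C \<and>
     (\<forall>i \<in> Obj J. \<pi> i \<in> Hom C L (Fo i)) \<and>
     (\<forall>k \<in> Arr J. Comp C (Fa k) (\<pi> (Dom J k)) = \<pi> (Cod J k))"

definition is_limit ::
  "('i, 'k) cat \<Rightarrow> ('o, 'm) cat \<Rightarrow> ('i \<Rightarrow> 'o) \<Rightarrow> ('k \<Rightarrow> 'm) \<Rightarrow> 'o \<Rightarrow> ('i \<Rightarrow> 'm) \<Rightarrow> bool" where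
  "is_limit J C Fo Fa L \<pi> \<longleftrightarrow>
     is_cone J C Fo Fa L \<pi> \<and>
     (\<forall>M \<sigma>. is_cone J C Fo Fa M \<sigma> \<longrightarrow>
        (\<exists>!h. h \<in> Hom C M L \<and> (\<forall>i \<in> Obj J. Comp C (\<pi> i) h = \<sigma> i)))"

text \<open>Every finite category is isomorphic to one whose objects and arrows are natural
  numbers, so it suffices to take index categories of that type.\<close>

definition has_finite_limits :: "('o, 'm) cat \<Rightarrow> bool" where
  "has_finite_limits C \<longleftrightarrow>
     (\<forall>(J :: (nat, nat) cat) Fo Fa.
        category J \<and> finite (Obj J) \<and> finite (Arr J) \<and> is_functor J C Fo Fa \<longrightarrow>
        (\<exists>L \<pi>. is_limit J C Fo Fa L \<pi>))"

definition is_terminal :: "('o, 'm) cat \<Rightarrow> 'o \<Rightarrow> bool" where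
  "is_terminal C T \<longleftrightarrow> T \<in> Obj C \<and> (\<forall>X \<in> Obj C. \<exists>!h. h \<in> Hom C X T)"

definition is_pullback ::
  "('o, 'm) cat \<Rightarrow> 'm \<Rightarrow> 'm \<Rightarrow> 'o \<Rightarrow> 'm \<Rightarrow> 'm \<Rightarrow> bool" where
  "is_pullback C f g P a b \<longleftrightarrow>
     P \<in> Obj C \<and> a \<in> Hom C P (Dom C f) \<and> b \<in> Hom C P (Dom C g) \<and>
     Comp C f a = Comp C g b \<and>
     (\<forall>Q \<in> Obj C. \<forall>c \<in> Hom C Q (Dom C f). \<forall>d \<in> Hom C Q (Dom C g).
        Comp C f c = Comp C g d \<longrightarrow>
        (\<exists>!h. h \<in> Hom C Q P \<and> Comp C a h = c \<and> Comp C b h = d))"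


section \<open>Dependent adders\<close>

text \<open>The pullback of \<open>x : U \<rightarrow> A\<close> and \<open>p : F \<rightarrow> A\<close> is the object \<open>br x\<close> with its projections
  \<open>pr x\<close> to \<open>U\<close> and \<open>fib x\<close> to \<open>F\<close>; these chosen pullbacks are part of the data.\<close>

locale dependent_adder_base = category C
  for C :: "('o, 'm) cat" (structure) +
  fixes T A F :: 'o
    and p unitF :: 'm
    and br :: "'m \<Rightarrow> 'o"
    and pr fib :: "'m \<Rightarrow> 'm"
  assumes finite_limits: "has_finite_limits C"
    and terminal: "is_terminal C T"
    and A_obj: "A \<in> Obj C"
    and p_hom: "p \<in> Hom C F A"
    and unitF_hom: "unitF \<in> Hom C T F"
    and pullback: "x \<in> Hom C U A \<Longrightarrow> is_pullback C x p (br x) (pr x) (fib x)"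
begin

definition unitA :: 'm where
  "unitA = p \<odot> unitF"

definition const_unit :: "'o \<Rightarrow> 'm" where
  "const_unit X = unitA \<odot> (THE t. t \<in> Hom C X T)"

text \<open>\<open>lift h y\<close> is \<open>h \<times>\<^sub>A id\<^sub>F\<close>, from the pullback of \<open>y \<odot> h\<close> to the pullback of \<open>y\<close>.\<close>

definition lift :: "'m \<Rightarrow> 'm \<Rightarrow> 'm" where
  "lift h y = (THE k. k \<in> Hom C (br (y \<odot> h)) (br y) \<and>
     pr y \<odot> k = h \<odot> pr (y \<odot> h) \<and>
     fib y \<odot> k = fib (y \<odot> h))"

text \<open>The conditions say that the map preserves the component in \<open>U\<close> and both components
  in \<open>F\<close>, the one over \<open>x\<close> and the one over \<open>y\<close>.\<close>

definition switch :: "'m \<Rightarrow> 'm \<Rightarrow> 'm" where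
  "switch x y = (THE k. k \<in> Hom C (br (y \<odot> pr x)) (br (x \<odot> pr y)) \<and>
     pr y \<odot> pr (x \<odot> pr y) \<odot> k = pr x \<odot> pr (y \<odot> pr x) \<and>
     fib (x \<odot> pr y) \<odot> k = fib x \<odot> pr (y \<odot> pr x) \<and>
     fib y \<odot> pr (x \<odot> pr y) \<odot> k = fib (y \<odot> pr x))"

end

locale dependent_adder = dependent_adder_base C T A F p unitF br pr fib
  for C :: "('o, 'm) cat" (structure) and T A F p unitF br pr fib +
  fixes dsum :: "'m \<Rightarrow> 'm \<Rightarrow> 'm"
    and flat :: "'m \<Rightarrow> 'm \<Rightarrow> 'm"
  assumes sum_hom:
      "\<lbrakk>x \<in> Hom C U A; f \<in> Hom C (br x) A\<rbrakk> \<Longrightarrow> dsum x f \<in> Hom C U A"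
    and sum_natural:
      "\<lbrakk>h \<in> Hom C U U'; y \<in> Hom C U' A; g \<in> Hom C (br y) A\<rbrakk>
        \<Longrightarrow> dsum (y \<odot> h) (g \<odot> lift h y) = dsum y g \<odot> h"
    and flat_hom:
      "\<lbrakk>x \<in> Hom C U A; f \<in> Hom C (br x) A\<rbrakk> \<Longrightarrow> flat x f \<in> Hom C (br f) (br (dsum x f))"
    and flat_over:
      "\<lbrakk>x \<in> Hom C U A; f \<in> Hom C (br x) A\<rbrakk>
        \<Longrightarrow> pr (dsum x f) \<odot> flat x f = pr x \<odot> pr f"
    and right_unit:
      "x \<in> Hom C U A \<Longrightarrow> dsum x (const_unit (br x)) = x"
    and left_unit:
      "\<lbrakk>x \<in> Hom C U A; f \<in> Hom C (br x) A\<rbrakk>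
        \<Longrightarrow> dsum (const_unit (br x)) (f \<odot> flat x (const_unit (br x))) = f"
    and sum_assoc:
      "\<lbrakk>x \<in> Hom C U A; f \<in> Hom C (br x) A; g \<in> Hom C (br (dsum x f)) A\<rbrakk>
        \<Longrightarrow> dsum (dsum x f) g = dsum x (dsum f (g \<odot> flat x f))"
    and flatten_assoc:
      "\<lbrakk>x \<in> Hom C U A; f \<in> Hom C (br x) A; g \<in> Hom C (br (dsum x f)) A\<rbrakk>
        \<Longrightarrow> flat (dsum x f) g \<odot> lift (flat x f) g =
            flat x (dsum f (g \<odot> flat x f)) \<odot> flat f (g \<odot> flat x f)"

locale commutative_dependent_adder =
  dependent_adder C T A F p unitF br pr fib dsum flat
  for C :: "('o, 'm) cat" (structure) and T A F p unitF br pr fib dsum flat +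
  assumes commutative:
    "\<lbrakk>x \<in> Hom C U A; y \<in> Hom C U A; f \<in> Hom C (br (x \<odot> pr y)) A\<rbrakk>
      \<Longrightarrow> dsum y (dsum (x \<odot> pr y) f) = dsum x (dsum (y \<odot> pr x) (f \<odot> switch x y))"


section \<open>The category of metrizable spaces\<close>

text \<open>A category has a single type of objects, so the spaces have to live in a common
  universe of points. For an arbitrary type \<open>'v\<close> the universe below contains all elements of
  \<open>'v\<close> and all reals and is closed under finite tuples; each metrizable \<open>'v topology\<close> thus
  has a homeomorphic copy among the objects.\<close>

datatype 'v point = Atom 'v | Num (num: real) | Tup "'v point list"

type_synonym 'v map = "'v point topology \<times> 'v point topology \<times> ('v point \<Rightarrow> 'v point)"

abbreviation src :: "'v map \<Rightarrow> 'v point topology" where "src f \<equiv> fst f"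
abbreviation trg :: "'v map \<Rightarrow> 'v point topology" where "trg f \<equiv> fst (snd f)"
abbreviation app :: "'v map \<Rightarrow> 'v point \<Rightarrow> 'v point" where "app f \<equiv> snd (snd f)"

definition mk_map ::
  "'v point topology \<Rightarrow> 'v point topology \<Rightarrow> ('v point \<Rightarrow> 'v point) \<Rightarrow> 'v map" where
  "mk_map X Y f = (X, Y, restrict f (topspace X))"

definition Top_mtr :: "('v point topology, 'v map) cat" where
  "Top_mtr = \<lparr>
     Obj = {X. metrizable_space X},
     Arr = {(X, Y, f). metrizable_space X \<and> metrizable_space Y \<and>
              continuous_map X Y f \<and> f \<in> extensional (topspace X)},
     Dom = src,
     Cod = trg,
     Ide = (\<lambda>X. mk_map X X (\<lambda>u. u)),
     Comp = (\<lambda>g f. mk_map (src f) (trg g) (\<lambda>u. app g (app f u))) \<rparr>"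


section \<open>The data on the nonnegative reals\<close>

text \<open>The constant \<^const>\<open>pullback_topology\<close> transports the subspace topology along the
  injective decoding of the points in question. The point \<open>(u, a)\<close> is encoded as
  \<open>Tup [u, Num a]\<close>.\<close>

fun base :: "'v point \<Rightarrow> 'v point" where
  "base (Tup [u, v]) = u"

fun height :: "'v point \<Rightarrow> real" where
  "height (Tup [u, v]) = num v"

definition one_space :: "'v point topology" where
  "one_space = discrete_topology {Tup []}"

definition Rnn :: "'v point topology" where
  "Rnn = pullback_topology (Num ` {0..}) num euclideanreal"

definition RF :: "'v point topology" where
  "RF = pullback_topology {Tup [Num x, Num y] | x y. 0 \<le> x \<and> 0 \<le> y \<and> y \<le> x}
          (\<lambda>z. (num (base z), height z)) (euclidean :: (real \<times> real) topology)"

definition Rp :: "'v map" where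
  "Rp = mk_map RF Rnn base"

definition Runit :: "'v map" where
  "Runit = mk_map one_space RF (\<lambda>_. Tup [Num 1, Num 1])"

definition Rbr :: "'v map \<Rightarrow> 'v point topology" where
  "Rbr x = pullback_topology
     {Tup [u, Num a] | u a. u \<in> topspace (src x) \<and> 0 \<le> a \<and> a \<le> num (app x u)}
     (\<lambda>z. (base z, height z)) (prod_topology (src x) euclideanreal)"

definition Rpr :: "'v map \<Rightarrow> 'v map" where
  "Rpr x = mk_map (Rbr x) (src x) base"

definition Rfib :: "'v map \<Rightarrow> 'v map" where
  "Rfib x = mk_map (Rbr x) RF (\<lambda>z. Tup [app x (base z), Num (height z)])"

definition Rsum :: "'v map \<Rightarrow> 'v map \<Rightarrow> 'v map" where
  "Rsum x f = mk_map (src x) Rnn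
     (\<lambda>u. Num (integral {0..num (app x u)} (\<lambda>t. num (app f (Tup [u, Num t])))))"

text \<open>A point \<open>z = (u, a, b)\<close> of \<open>Rbr f\<close> is \<open>((u, a), b)\<close>; its coordinate \<open>b\<close> does not enter
  the formula.\<close>

definition Rflat :: "'v map \<Rightarrow> 'v map \<Rightarrow> 'v map" where
  "Rflat x f = mk_map (Rbr f) (Rbr (Rsum x f))
     (\<lambda>z. let u = base (base z); a = height (base z)
          in Tup [u, Num (integral {0..a} (\<lambda>t. num (app f (Tup [u, Num t]))))])"

end

theory Submission
  imports Defs
begin

text \<open>
  Every morphism into the nonnegative reals is a nonnegative continuous function, and a point of
  the pullback \<open>Rbr x\<close> is a point \<open>u\<close> together with a height \<open>a\<close> between \<open>0\<close> and \<open>x u\<close>. Once the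
  universally characterised maps are identified with explicit formulas (\<open>lift_eq\<close>,
  \<open>switch_eq\<close>), each axiom compares two maps at a single point \<open>u\<close>, where it is a fact about
  integrals over intervals. The unit axioms integrate the constant \<open>1\<close>. For associativity put
  \<open>S a = \<integral>\<^sub>0\<^sup>a f(u,t) dt\<close>. Then
  \<open>\<integral> g(u,s) ds\<close> over \<open>0 \<le> s \<le> S a\<close> equals \<open>\<integral> f(u,t) g(u, S t) dt\<close> over \<open>0 \<le> t \<le> a\<close>, by substituting
  \<open>s = S t\<close> (\<open>integral_substitution_primitive\<close>, \<open>fibre_integral_assoc\<close>); the factor \<open>f(u,t)\<close> is the
  integral of a constant over the fibre of length \<open>f(u,t)\<close>, which is how the iterated sum arises.
  Commutativity is Fubini's theorem on a rectangle (\<open>Rsum_commute\<close>).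

  What remains is topological. The integrals depend continuously on the parameter \<open>u\<close>, although
  both the integrand and the upper bound vary with it (\<open>continuous_map_integral_upto\<close>). The spaces
  are encoded inside one type of points by pulling back topologies along injective
  decodings, which yields homeomorphic copies of the intended subspaces of products and so
  preserves metrizability (\<open>metrizable_space_pullback_topology\<close>). Finite limits are encoded in the
  same way (\<open>finite_limits_Top_mtr\<close>).
\<close>

section \<open>Pullback topologies along injections\<close>

lemma continuous_map_pullback_topology_decode:
  "continuous_map (pullback_topology A d T) T d"
  using continuous_map_pullback[OF continuous_map_id, of A d T] by simp

lemma continuous_map_into_pullback_topology_iff:
  "continuous_map X (pullback_topology A d T) g \<longleftrightarrow>
     continuous_map X T (\<lambda>u. d (g u)) \<and> (\<forall>u \<in> topspace X. g u \<in> A)"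
proof
  assume g: "continuous_map X (pullback_topology A d T) g"
  then have "continuous_map X T (d \<circ> g)"
    by (rule continuous_map_compose[OF _ continuous_map_pullback_topology_decode])
  moreover have "\<forall>u \<in> topspace X. g u \<in> A"
    using continuous_map_funspace[OF g] by (auto simp: topspace_pullback_topology)
  ultimately show "continuous_map X T (\<lambda>u. d (g u)) \<and> (\<forall>u \<in> topspace X. g u \<in> A)"
    by (simp add: o_def)
next
  assume "continuous_map X T (\<lambda>u. d (g u)) \<and> (\<forall>u \<in> topspace X. g u \<in> A)"
  then show "continuous_map X (pullback_topology A d T) g"
    by (intro continuous_map_pullback') (auto simp: o_def)
qed

text \<open>An injective decoding is a homeomorphism onto its image with the subspace topology. All
  encoded spaces below, including the limits, owe their metrizability to this.\<close>

lemma metrizable_space_pullback_topology: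
  assumes T: "metrizable_space T" and d: "inj_on d A"
  shows "metrizable_space (pullback_topology A d T)"
proof -
  let ?P = "pullback_topology A d T"
  have "continuous_map (subtopology T (d ` A)) ?P (inv_into A d)"
    unfolding continuous_map_into_pullback_topology_iff
  proof
    show "continuous_map (subtopology T (d ` A)) T (\<lambda>u. d (inv_into A d u))"
      by (rule continuous_map_eq[of _ _ "\<lambda>u. u"]) (auto simp: f_inv_into_f)
  qed (auto simp: inv_into_into)
  moreover have "continuous_map ?P (subtopology T (d ` A)) d"
    by (intro continuous_map_into_subtopology continuous_map_pullback_topology_decode)
      (auto simp: topspace_pullback_topology)
  ultimately have "homeomorphic_maps ?P (subtopology T (d ` A)) d (inv_into A d)"
    using d by (auto simp: homeomorphic_maps_def topspace_pullback_topology f_inv_into_f)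
  then have "?P homeomorphic_space subtopology T (d ` A)"
    by (auto simp: homeomorphic_space_def)
  then show ?thesis
    using homeomorphic_metrizable_space metrizable_space_subtopology[OF T] by blast
qed

section \<open>Parametric integrals\<close>

text \<open>Compactness of the interval replaces uniform continuity:
  the set where \<open>g z s\<close> differs from \<open>g z0 s\<close> by less than \<open>e/2\<close> contains a tube around
  \<open>{z0} \<times> {0..1}\<close>, and on that tube the integrals differ by at most \<open>e/2\<close>.\<close>

lemma continuous_map_integral_unit_interval:
  fixes g :: "'a \<Rightarrow> real \<Rightarrow> real"
  assumes g: "continuous_map (prod_topology X (top_of_set {0..1})) euclideanreal (\<lambda>(z, s). g z s)"
  shows "continuous_map X euclideanreal (\<lambda>z. integral {0..1} (g z))"
proof -
  have slice: "continuous_on {0..1} (g z)" if "z \<in> topspace X" for z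
  proof -
    have "continuous_map (top_of_set {0..1}) (prod_topology X (top_of_set {0..1})) (\<lambda>s. (z, s))"
      using that by (intro continuous_map_pairedI) auto
    from continuous_map_compose[OF this g] show ?thesis by (simp add: o_def)
  qed
  have "\<exists>U. openin X U \<and> z0 \<in> U \<and> (\<forall>z \<in> U. \<bar>integral {0..1} (g z) - integral {0..1} (g z0)\<bar> < e)"
    if z0: "z0 \<in> topspace X" and e: "e > 0" for z0 e
  proof -
    let ?P = "prod_topology X (top_of_set {0..1::real})"
    have "continuous_map ?P euclideanreal (\<lambda>w. g z0 (snd w))"
      using continuous_map_compose[OF continuous_map_snd, of "top_of_set {0..1}" euclideanreal "g z0" X]
        slice[OF z0] by (simp add: o_def)
    with g have d: "continuous_map ?P euclideanreal (\<lambda>w. g (fst w) (snd w) - g z0 (snd w))"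
      by (intro continuous_intros) (auto simp: case_prod_unfold)
    define W where "W = {w \<in> topspace ?P. g (fst w) (snd w) - g z0 (snd w) \<in> {-(e/2)<..<e/2}}"
    have "openin ?P W"
      unfolding W_def by (rule openin_continuous_map_preimage[OF d]) auto
    moreover have "compactin (top_of_set {0..1::real}) {0..1}"
      by (simp add: compactin_subtopology)
    moreover have "{z0} \<times> {0..1} \<subseteq> W"
      using z0 e by (auto simp: W_def)
    ultimately obtain U V where UV: "openin X U" "z0 \<in> U" "{0..1} \<subseteq> V" "U \<times> V \<subseteq> W"
      using tube_lemma_right[of X "top_of_set {0..1::real}" W "{0..1}" z0] z0 by blast
    have "\<bar>integral {0..1} (g z) - integral {0..1} (g z0)\<bar> < e" if z: "z \<in> U" for z
    proof -
      have zX: "z \<in> topspace X" using UV(1) z openin_subset by blast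
      have "norm (integral {0..1} (\<lambda>s. g z s - g z0 s)) \<le> e/2 * (1 - 0)"
      proof (rule integral_bound)
        show "continuous_on {0..1} (\<lambda>s. g z s - g z0 s)"
          by (intro continuous_on_diff slice z0 zX)
        fix s :: real assume "s \<in> {0..1}"
        then have "(z, s) \<in> W" using UV z by blast
        then have "-(e/2) < g z s - g z0 s" "g z s - g z0 s < e/2" by (auto simp: W_def)
        then show "norm (g z s - g z0 s) \<le> e/2" unfolding real_norm_def by linarith
      qed simp
      moreover have "integral {0..1} (\<lambda>s. g z s - g z0 s) = integral {0..1} (g z) - integral {0..1} (g z0)"
        by (intro integral_diff integrable_continuous_interval slice z0 zX)
      ultimately show ?thesis using e by simp
    qed
    then show ?thesis using UV by blast
  qed
  then show ?thesis
    using Met_TC.continuous_map_to_metric[of X "\<lambda>z. integral {0..1} (g z)"]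
    by (simp add: Met_TC.mball_def dist_real_def abs_minus_commute)
qed

text \<open>The integrand is only defined below the varying bound \<open>c z\<close>. Substituting \<open>t = c z * s\<close>
  moves everything to the fixed unit interval; this includes the case \<open>c z = 0\<close>, in which both
  integrals vanish.\<close>

lemma continuous_map_integral_upto:
  fixes g :: "'a \<Rightarrow> real \<Rightarrow> real"
  assumes c: "continuous_map X euclideanreal c" and c0: "\<And>z. z \<in> topspace X \<Longrightarrow> 0 \<le> c z"
    and g: "continuous_map (subtopology (prod_topology X euclideanreal) {(z, t). 0 \<le> t \<and> t \<le> c z})
      euclideanreal (\<lambda>(z, t). g z t)"
  shows "continuous_map X euclideanreal (\<lambda>z. integral {0..c z} (g z))"
proof -
  let ?P = "prod_topology X (top_of_set {0..1::real})"
  have slice: "continuous_on {0..c z} (g z)" if "z \<in> topspace X" for z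
  proof -
    have "continuous_map (top_of_set {0..c z})
        (subtopology (prod_topology X euclideanreal) {(z, t). 0 \<le> t \<and> t \<le> c z}) (\<lambda>t. (z, t))"
      using that by (intro continuous_map_into_subtopology continuous_map_pairedI) auto
    from continuous_map_compose[OF this g] show ?thesis by (simp add: o_def)
  qed
  have cP: "continuous_map ?P euclideanreal (\<lambda>w. c (fst w))"
    using continuous_map_compose[OF continuous_map_fst c] by (simp add: o_def)
  have sP: "continuous_map ?P euclideanreal snd"
    using continuous_map_into_fulltopology[OF continuous_map_snd] .
  have "continuous_map ?P (subtopology (prod_topology X euclideanreal) {(z, t). 0 \<le> t \<and> t \<le> c z})
      (\<lambda>w. (fst w, c (fst w) * snd w))"
    by (intro continuous_map_into_subtopology continuous_map_pairedI continuous_map_real_mult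
        continuous_map_fst cP sP) (auto simp: c0 mult_left_le)
  from continuous_map_compose[OF this g]
  have "continuous_map ?P euclideanreal (\<lambda>w. g (fst w) (c (fst w) * snd w))"
    by (simp add: o_def)
  with cP have "continuous_map ?P euclideanreal (\<lambda>w. c (fst w) * g (fst w) (c (fst w) * snd w))"
    by (rule continuous_map_real_mult)
  then have "continuous_map X euclideanreal (\<lambda>z. integral {0..1} (\<lambda>s. c z * g z (c z * s)))"
    by (intro continuous_map_integral_unit_interval) (simp add: case_prod_unfold)
  then show ?thesis
  proof (rule continuous_map_eq)
    fix z assume z: "z \<in> topspace X"
    have "((\<lambda>s. c z *\<^sub>R g z (c z * s)) has_integral integral {c z * 0..c z * 1} (g z)) {0..1}"
      using c0[OF z] slice[OF z]
      by (intro has_integral_substitution[where c = 0 and d = "c z"])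
        (auto simp: mult_left_le intro!: derivative_eq_intros)
    from integral_unique[OF this]
    show "integral {0..1} (\<lambda>s. c z * g z (c z * s)) = integral {0..c z} (g z)" by simp
  qed
qed

text \<open>The inner integral has a constant integrand and equals \<open>F t * G (S t)\<close> for the primitive
  \<open>S\<close> of \<open>F\<close>; as \<open>F\<close> is the derivative of \<open>S\<close>, this is the substitution \<open>s = S t\<close>. The
  left-hand side is kept in the form of an iterated sum, in which both associativity axioms
  present it.\<close>

lemma integral_substitution_primitive:
  fixes F G :: "real \<Rightarrow> real"
  assumes a: "0 \<le> a" and F: "continuous_on {0..a} F" and F0: "\<And>t. t \<in> {0..a} \<Longrightarrow> 0 \<le> F t"
    and G: "continuous_on {0..integral {0..a} F} G"
  shows "integral {0..a} (\<lambda>t. integral {0..F t} (\<lambda>_. G (integral {0..t} F))) =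
    integral {0..integral {0..a} F} G"
proof -
  let ?S = "\<lambda>t. integral {0..t} F"
  have int: "F integrable_on {0..t}" if "t \<in> {0..a}" for t
    using that by (intro integrable_continuous_interval continuous_on_subset[OF F]) auto
  have S: "0 \<le> ?S t \<and> ?S t \<le> ?S a" if "t \<in> {0..a}" for t
  proof
    show "0 \<le> ?S t"
      using that F0 by (intro integral_nonneg int) simp_all
    show "?S t \<le> ?S a"
      using that F0 a by (intro integral_subset_le int) simp_all
  qed
  have "((\<lambda>t. F t *\<^sub>R G (?S t)) has_integral integral {?S 0..?S a} G) {0..a}"
  proof (rule has_integral_substitution[where c = 0 and d = "?S a"])
    show "?S 0 \<le> ?S a"
      using S[of 0] a by simp
    show "?S ` {0..a} \<subseteq> {0..?S a}"
      using S by (intro image_subsetI) simp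
  qed (use a G integral_has_real_derivative[OF F] in blast)+
  then have "integral {0..a} (\<lambda>t. F t * G (?S t)) = integral {0..?S a} G"
    by (simp add: integral_unique)
  moreover have "integral {0..a} (\<lambda>t. integral {0..F t} (\<lambda>_. G (?S t))) = integral {0..a} (\<lambda>t. F t * G (?S t))"
    by (rule integral_cong) (simp add: F0)
  ultimately show ?thesis by simp
qed

section \<open>The category of metrizable spaces\<close>

lemma src_mk_map [simp]: "src (mk_map X Y f) = X"
  and trg_mk_map [simp]: "trg (mk_map X Y f) = Y"
  and app_mk_map: "app (mk_map X Y f) = restrict f (topspace X)"
  by (simp_all add: mk_map_def)

lemma app_mk_map_apply [simp]: "u \<in> topspace X \<Longrightarrow> app (mk_map X Y f) u = f u"
  by (simp add: app_mk_map)

lemma mk_map_cong: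
  assumes "\<And>u. u \<in> topspace X \<Longrightarrow> f u = g u"
  shows "mk_map X Y f = mk_map X Y g"
  using assms by (auto simp: mk_map_def restrict_def)

lemma Top_mtr_simps [simp]:
  "X \<in> Obj Top_mtr \<longleftrightarrow> metrizable_space X"
  "Dom Top_mtr = src" "Cod Top_mtr = trg"
  "Ide Top_mtr X = mk_map X X (\<lambda>u. u)"
  by (simp_all add: Top_mtr_def)

lemma Comp_Top_mtr: "Comp Top_mtr g f = mk_map (src f) (trg g) (\<lambda>u. app g (app f u))"
  by (simp add: Top_mtr_def)

lemma Comp_Top_mtr_simps [simp]:
  "src (Comp Top_mtr g f) = src f"
  "trg (Comp Top_mtr g f) = trg g"
  "u \<in> topspace (src f) \<Longrightarrow> app (Comp Top_mtr g f) u = app g (app f u)"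
  by (simp_all add: Comp_Top_mtr)

lemma Hom_Top_mtr_iff:
  "f \<in> Hom Top_mtr X Y \<longleftrightarrow> src f = X \<and> trg f = Y \<and> metrizable_space X \<and> metrizable_space Y \<and>
     continuous_map X Y (app f) \<and> app f \<in> extensional (topspace X)"
  by (cases f) (auto simp: Hom_def Top_mtr_def)

lemma mk_map_in_Hom:
  "\<lbrakk>metrizable_space X; metrizable_space Y; continuous_map X Y f\<rbrakk> \<Longrightarrow> mk_map X Y f \<in> Hom Top_mtr X Y"
  by (simp add: Hom_Top_mtr_iff app_mk_map)

lemma Hom_Top_mtrD:
  assumes "f \<in> Hom Top_mtr X Y"
  shows "src f = X" "trg f = Y" "metrizable_space X" "metrizable_space Y"
    "continuous_map X Y (app f)" "u \<in> topspace X \<Longrightarrow> app f u \<in> topspace Y"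
  using assms continuous_map_funspace[of X Y "app f"] by (auto simp: Hom_Top_mtr_iff)

lemma Hom_Top_mtr_eqI:
  assumes "f \<in> Hom Top_mtr X Y" "g \<in> Hom Top_mtr X Y"
    and "\<And>u. u \<in> topspace X \<Longrightarrow> app f u = app g u"
  shows "f = g"
  using assms by (auto simp: Hom_Top_mtr_iff prod_eq_iff intro: extensionalityI)

lemma Comp_in_Hom_Top_mtr:
  assumes "f \<in> Hom Top_mtr X Y" "g \<in> Hom Top_mtr Y Z"
  shows "Comp Top_mtr g f \<in> Hom Top_mtr X Z"
  using assms continuous_map_compose[of X Y "app f" Z "app g"]
  by (auto simp: Comp_Top_mtr Hom_Top_mtr_iff o_def app_mk_map)

lemma category_Top_mtr: "category (Top_mtr :: ('v point topology, 'v map) cat)"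
proof
  fix f :: "'v map" assume "f \<in> Arr Top_mtr"
  then show "Dom Top_mtr f \<in> Obj Top_mtr" "Cod Top_mtr f \<in> Obj Top_mtr"
    by (auto simp: Top_mtr_def)
next
  fix X :: "'v point topology" assume "X \<in> Obj Top_mtr"
  then show "Ide Top_mtr X \<in> Hom Top_mtr X X"
    by (simp add: mk_map_in_Hom)
next
  fix f g :: "'v map" and X Y Z assume "f \<in> Hom Top_mtr X Y" "g \<in> Hom Top_mtr Y Z"
  then show "Comp Top_mtr g f \<in> Hom Top_mtr X Z" by (rule Comp_in_Hom_Top_mtr)
next
  fix f :: "'v map" and X Y assume f: "f \<in> Hom Top_mtr X Y"
  note fD = Hom_Top_mtrD[OF f]
  have ide: "Ide Top_mtr X \<in> Hom Top_mtr X X" "Ide Top_mtr Y \<in> Hom Top_mtr Y Y"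
    by (simp_all add: mk_map_in_Hom fD)
  show "Comp Top_mtr f (Ide Top_mtr X) = f"
    by (rule Hom_Top_mtr_eqI[OF Comp_in_Hom_Top_mtr[OF ide(1) f] f]) simp
  show "Comp Top_mtr (Ide Top_mtr Y) f = f"
    by (rule Hom_Top_mtr_eqI[OF Comp_in_Hom_Top_mtr[OF f ide(2)] f]) (simp add: fD)
next
  fix f g h :: "'v map" and W X Y Z
  assume f: "f \<in> Hom Top_mtr W X" and g: "g \<in> Hom Top_mtr X Y" and h: "h \<in> Hom Top_mtr Y Z"
  show "Comp Top_mtr (Comp Top_mtr h g) f = Comp Top_mtr h (Comp Top_mtr g f)"
    by (rule Hom_Top_mtr_eqI[OF Comp_in_Hom_Top_mtr[OF f Comp_in_Hom_Top_mtr[OF g h]]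
          Comp_in_Hom_Top_mtr[OF Comp_in_Hom_Top_mtr[OF f g] h]])
      (simp add: Hom_Top_mtrD[OF f] Hom_Top_mtrD[OF g])
qed

text \<open>The limit of a finite diagram is the subspace of compatible families in the product of its
  spaces. Families are functions on the index objects and not points, so they are encoded by the
  tuples of their values and the topology is transported back along the decoding. Closure of the
  universe of points under finite tuples is what makes this possible.\<close>

lemma finite_limits_Top_mtr: "has_finite_limits (Top_mtr :: ('v point topology, 'v map) cat)"
  unfolding has_finite_limits_def
proof (intro allI impI)
  fix J :: "(nat, nat) cat" and Fo :: "nat \<Rightarrow> 'v point topology" and Fa :: "nat \<Rightarrow> 'v map"
  assume "category J \<and> finite (Obj J) \<and> finite (Arr J) \<and> is_functor J Top_mtr Fo Fa"
  then have J: "category J" and fin: "finite (Obj J)" and "is_functor J Top_mtr Fo Fa"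
    by auto
  then have Fo: "\<And>i. i \<in> Obj J \<Longrightarrow> metrizable_space (Fo i)"
    and Fa: "\<And>k. k \<in> Arr J \<Longrightarrow> Fa k \<in> Hom Top_mtr (Fo (Dom J k)) (Fo (Cod J k))"
    by (auto simp: is_functor_def)
  have dom: "Dom J k \<in> Obj J" and cod: "Cod J k \<in> Obj J" if "k \<in> Arr J" for k
    using category.dom_obj[OF J that] category.cod_obj[OF J that] by auto
  \<comment> \<open>\<open>e\<close> encodes a family as a point, \<open>T\<close> is the limit before encoding.\<close>
  define e :: "(nat \<Rightarrow> 'v point) \<Rightarrow> 'v point" where "e \<phi> = Tup (map \<phi> (sorted_list_of_set (Obj J)))" for \<phi>
  define T where "T = subtopology (product_topology Fo (Obj J))
    {\<phi>. \<forall>k \<in> Arr J. app (Fa k) (\<phi> (Dom J k)) = \<phi> (Cod J k)}"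
  let ?d = "inv_into (topspace T) e"
  define L where "L = pullback_topology (e ` topspace T) ?d T"
  have T: "\<phi> \<in> topspace T \<longleftrightarrow> \<phi> \<in> (\<Pi>\<^sub>E i \<in> Obj J. topspace (Fo i)) \<and>
      (\<forall>k \<in> Arr J. app (Fa k) (\<phi> (Dom J k)) = \<phi> (Cod J k))" for \<phi>
    by (auto simp: T_def)
  have inj: "inj_on e (topspace T)"
  proof (rule inj_onI)
    fix \<phi> \<psi> assume "\<phi> \<in> topspace T" "\<psi> \<in> topspace T" "e \<phi> = e \<psi>"
    then show "\<phi> = \<psi>"
      using fin by (auto simp: T e_def intro: PiE_ext)
  qed
  have d_e: "?d (e \<phi>) = \<phi>" if "\<phi> \<in> topspace T" for \<phi>
    using inj that by (rule inv_into_f_f)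
  have L: "topspace L = e ` topspace T"
    by (auto simp: L_def topspace_pullback_topology d_e)
  have mT: "metrizable_space T"
    unfolding T_def using fin Fo
    by (intro metrizable_space_subtopology) (auto simp: metrizable_space_product_topology countable_finite)
  have mL: "metrizable_space L"
    unfolding L_def using mT inj by (intro metrizable_space_pullback_topology) (auto intro!: inj_on_inv_into)
  define \<pi> where "\<pi> i = mk_map L (Fo i) (\<lambda>z. ?d z i)" for i
  have \<pi>: "\<pi> i \<in> Hom Top_mtr L (Fo i)" if i: "i \<in> Obj J" for i
  proof -
    have "continuous_map T (Fo i) (\<lambda>\<phi>. \<phi> i)"
      unfolding T_def by (intro continuous_map_from_subtopology continuous_map_product_projection i)
    then have "continuous_map L (Fo i) ((\<lambda>\<phi>. \<phi> i) \<circ> ?d)"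
      unfolding L_def by (rule continuous_map_pullback)
    then show ?thesis
      unfolding \<pi>_def by (intro mk_map_in_Hom mL Fo i) (simp add: o_def)
  qed
  have "is_cone J Top_mtr Fo Fa L \<pi>"
    unfolding is_cone_def
  proof (intro conjI ballI)
    fix k assume k: "k \<in> Arr J"
    show "Comp Top_mtr (Fa k) (\<pi> (Dom J k)) = \<pi> (Cod J k)"
    proof (rule Hom_Top_mtr_eqI[OF Comp_in_Hom_Top_mtr[OF \<pi>[OF dom[OF k]] Fa[OF k]] \<pi>[OF cod[OF k]]])
      fix z assume "z \<in> topspace L"
      then show "app (Comp Top_mtr (Fa k) (\<pi> (Dom J k))) z = app (\<pi> (Cod J k)) z"
        using k by (auto simp: \<pi>_def L d_e T)
    qed
  qed (simp_all add: mL \<pi>)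
  moreover have "\<exists>!h. h \<in> Hom Top_mtr M L \<and> (\<forall>i \<in> Obj J. Comp Top_mtr (\<pi> i) h = \<sigma> i)"
    if "is_cone J Top_mtr Fo Fa M \<sigma>" for M \<sigma>
  proof -
    from that have mM: "metrizable_space M"
      and \<sigma>: "\<And>i. i \<in> Obj J \<Longrightarrow> \<sigma> i \<in> Hom Top_mtr M (Fo i)"
      and \<sigma>_nat: "\<And>k. k \<in> Arr J \<Longrightarrow> Comp Top_mtr (Fa k) (\<sigma> (Dom J k)) = \<sigma> (Cod J k)"
      by (auto simp: is_cone_def)
    define r where "r m = (\<lambda>i\<in>Obj J. app (\<sigma> i) m)" for m
    have r: "r m \<in> topspace T" if m: "m \<in> topspace M" for m
      unfolding T
    proof (intro conjI ballI)
      show "r m \<in> (\<Pi>\<^sub>E i \<in> Obj J. topspace (Fo i))"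
        using Hom_Top_mtrD(6)[OF \<sigma>] m by (auto simp: r_def)
      fix k assume k: "k \<in> Arr J"
      from \<sigma>_nat[OF k, THEN arg_cong, of "\<lambda>f. app f m"]
      show "app (Fa k) (r m (Dom J k)) = r m (Cod J k)"
        using Hom_Top_mtrD(1)[OF \<sigma>[OF dom[OF k]]] m by (simp add: r_def dom[OF k] cod[OF k])
    qed
    define h where "h = mk_map M L (\<lambda>m. e (r m))"
    have "continuous_map M (product_topology Fo (Obj J)) r"
      using Hom_Top_mtrD(5)[OF \<sigma>] unfolding continuous_map_componentwise
      by (auto simp: r_def image_subset_iff intro: continuous_map_eq)
    then have "continuous_map M T r"
      unfolding T_def using r by (auto simp: continuous_map_in_subtopology T)
    then have h: "h \<in> Hom Top_mtr M L"
      unfolding h_def using r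
      by (intro mk_map_in_Hom mM mL)
        (auto simp: L_def continuous_map_into_pullback_topology_iff d_e intro: continuous_map_eq)
    have \<pi>h: "Comp Top_mtr (\<pi> i) h = \<sigma> i" if i: "i \<in> Obj J" for i
    proof (rule Hom_Top_mtr_eqI[OF Comp_in_Hom_Top_mtr[OF h \<pi>[OF i]] \<sigma>[OF i]])
      fix m assume "m \<in> topspace M"
      then show "app (Comp Top_mtr (\<pi> i) h) m = app (\<sigma> i) m"
        using r[of m] i by (simp add: h_def \<pi>_def L d_e) (simp add: r_def)
    qed
    have "h' = h" if h': "h' \<in> Hom Top_mtr M L" and eq: "\<And>i. i \<in> Obj J \<Longrightarrow> Comp Top_mtr (\<pi> i) h' = \<sigma> i" for h'
    proof (rule Hom_Top_mtr_eqI[OF h' h])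
      fix m assume m: "m \<in> topspace M"
      then have "app h' m \<in> topspace L" using Hom_Top_mtrD(6)[OF h'] by blast
      then obtain \<phi> where \<phi>: "\<phi> \<in> topspace T" "app h' m = e \<phi>" by (auto simp: L)
      have "\<phi> i = r m i" if i: "i \<in> Obj J" for i
        using eq[OF i, THEN arg_cong, of "\<lambda>f. app f m"] \<phi> m i Hom_Top_mtrD(1)[OF h']
        by (simp add: \<pi>_def L d_e r_def)
      with \<phi>(1) r[OF m] have "\<phi> = r m"
        by (auto simp: T intro: PiE_ext)
      with \<phi>(2) m show "app h' m = app h m" by (simp add: h_def)
    qed
    with h \<pi>h show ?thesis by blast
  qed
  ultimately show "\<exists>L \<pi>. is_limit J Top_mtr Fo Fa L \<pi>"
    unfolding is_limit_def by blast
qed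

section \<open>The spaces of the adder and their pullbacks\<close>

lemma topspace_Rnn: "topspace Rnn = Num ` {0..}"
  by (auto simp: Rnn_def topspace_pullback_topology)

lemma metrizable_Rnn: "metrizable_space Rnn"
  unfolding Rnn_def
  by (intro metrizable_space_pullback_topology metrizable_space_euclidean) (auto simp: inj_on_def)

lemma continuous_map_into_Rnn_iff:
  "continuous_map X Rnn g \<longleftrightarrow>
     continuous_map X euclideanreal (\<lambda>u. num (g u)) \<and> (\<forall>u \<in> topspace X. g u \<in> Num ` {0..})"
  unfolding Rnn_def by (rule continuous_map_into_pullback_topology_iff)

lemma topspace_RF: "topspace RF = {Tup [Num x, Num y] | x y. 0 \<le> x \<and> 0 \<le> y \<and> y \<le> x}"
  by (auto simp: RF_def topspace_pullback_topology)

lemma metrizable_RF: "metrizable_space RF"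
  unfolding RF_def
  by (intro metrizable_space_pullback_topology metrizable_space_euclidean) (auto simp: inj_on_def)

lemma continuous_map_into_RF_iff:
  "continuous_map X RF g \<longleftrightarrow>
     continuous_map X euclideanreal (\<lambda>u. num (base (g u))) \<and>
     continuous_map X euclideanreal (\<lambda>u. height (g u)) \<and>
     (\<forall>u \<in> topspace X. g u \<in> topspace RF)"
  unfolding RF_def continuous_map_into_pullback_topology_iff
    prod_topology_euclidean[symmetric] continuous_map_pairwise
  by (auto simp: o_def topspace_pullback_topology simp del: prod_topology_euclidean)

lemma mem_topspace_Rbr [simp]:
  "Tup [u, Num a] \<in> topspace (Rbr x) \<longleftrightarrow> u \<in> topspace (src x) \<and> 0 \<le> a \<and> a \<le> num (app x u)"
  by (auto simp: Rbr_def topspace_pullback_topology)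

lemma topspace_RbrE:
  assumes "z \<in> topspace (Rbr x)"
  obtains u a where "z = Tup [u, Num a]" "u \<in> topspace (src x)" "0 \<le> a" "a \<le> num (app x u)"
  using assms by (auto simp: Rbr_def topspace_pullback_topology)

lemma metrizable_Rbr: "metrizable_space (src x) \<Longrightarrow> metrizable_space (Rbr x)"
  unfolding Rbr_def
  by (intro metrizable_space_pullback_topology)
    (auto simp: inj_on_def metrizable_space_prod_topology metrizable_space_euclidean)

text \<open>The space \<open>Rbr x\<close> carries the topology induced from \<open>src x\<close> and the real line, so continuity
  into it is continuity of the two components.\<close>

lemma continuous_map_into_Rbr_iff:
  "continuous_map Z (Rbr x) g \<longleftrightarrow>
     continuous_map Z (src x) (\<lambda>z. base (g z)) \<and>
     continuous_map Z euclideanreal (\<lambda>z. height (g z)) \<and>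
     (\<forall>z \<in> topspace Z. g z \<in> topspace (Rbr x))"
proof -
  have "topspace (Rbr x) = {Tup [u, Num a] | u a. u \<in> topspace (src x) \<and> 0 \<le> a \<and> a \<le> num (app x u)}"
    by (auto simp: Rbr_def topspace_pullback_topology)
  then show ?thesis
    unfolding Rbr_def continuous_map_into_pullback_topology_iff continuous_map_pairwise
    by (simp add: o_def)
qed

lemma continuous_map_base: "continuous_map (Rbr x) (src x) base"
  and continuous_map_height: "continuous_map (Rbr x) euclideanreal height"
  using continuous_map_id[of "Rbr x"] unfolding id_def continuous_map_into_Rbr_iff by simp_all

lemma topspace_Rbr_eqI:
  "\<lbrakk>z \<in> topspace (Rbr x); w \<in> topspace (Rbr x); base z = base w; height z = height w\<rbrakk> \<Longrightarrow> z = w"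
  by (auto elim!: topspace_RbrE)

lemma Hom_RnnD:
  assumes "f \<in> Hom Top_mtr X Rnn"
  shows "continuous_map X euclideanreal (\<lambda>u. num (app f u))"
    and "u \<in> topspace X \<Longrightarrow> 0 \<le> num (app f u)"
    and "u \<in> topspace X \<Longrightarrow> Num (num (app f u)) = app f u"
  using Hom_Top_mtrD(5,6)[OF assms] by (auto simp: continuous_map_into_Rnn_iff topspace_Rnn)

lemma Hom_Rnn_eqI:
  assumes f: "f \<in> Hom Top_mtr X Rnn" and g: "g \<in> Hom Top_mtr X Rnn"
    and "\<And>u. u \<in> topspace X \<Longrightarrow> num (app f u) = num (app g u)"
  shows "f = g"
  using assms(3) by (intro Hom_Top_mtr_eqI[OF f g]) (metis Hom_RnnD(3) f g)

lemma mk_map_in_Hom_Rnn: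
  assumes "metrizable_space X" "continuous_map X euclideanreal g"
    and "\<And>u. u \<in> topspace X \<Longrightarrow> 0 \<le> g u"
  shows "mk_map X Rnn (\<lambda>u. Num (g u)) \<in> Hom Top_mtr X Rnn"
  using assms by (intro mk_map_in_Hom metrizable_Rnn) (auto simp: continuous_map_into_Rnn_iff)

lemma metrizable_one_space: "metrizable_space one_space"
  by (simp add: one_space_def)

lemma mk_map_one_space:
  "metrizable_space X \<Longrightarrow> mk_map X one_space (\<lambda>_. Tup []) \<in> Hom Top_mtr X one_space"
  by (intro mk_map_in_Hom metrizable_one_space) (simp_all add: one_space_def)

lemma Hom_one_space_unique:
  assumes "t \<in> Hom Top_mtr X one_space"
  shows "t = mk_map X one_space (\<lambda>_. Tup [])"
  using Hom_Top_mtrD(3)[OF assms]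
  by (intro Hom_Top_mtr_eqI[OF assms mk_map_one_space])
    (use Hom_Top_mtrD(6)[OF assms] in \<open>auto simp: one_space_def\<close>)

lemma terminal_one_space: "is_terminal Top_mtr one_space"
  unfolding is_terminal_def using mk_map_one_space Hom_one_space_unique metrizable_one_space
  by (auto intro!: ex1I)

lemma Rp_in_Hom: "Rp \<in> Hom Top_mtr RF Rnn"
  unfolding Rp_def
proof (intro mk_map_in_Hom metrizable_RF metrizable_Rnn)
  show "continuous_map RF Rnn base"
    using continuous_map_id[of RF] unfolding id_def continuous_map_into_RF_iff
    by (auto simp: continuous_map_into_Rnn_iff topspace_RF)
qed

lemma Runit_in_Hom: "Runit \<in> Hom Top_mtr one_space RF"
  unfolding Runit_def
  by (intro mk_map_in_Hom metrizable_RF metrizable_one_space)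
    (simp add: continuous_map_into_RF_iff topspace_RF)

lemma Rpr_simps [simp]:
  "src (Rpr x) = Rbr x" "trg (Rpr x) = src x"
  "z \<in> topspace (Rbr x) \<Longrightarrow> app (Rpr x) z = base z"
  by (simp_all add: Rpr_def)

lemma Rfib_simps [simp]:
  "src (Rfib x) = Rbr x" "trg (Rfib x) = RF"
  "z \<in> topspace (Rbr x) \<Longrightarrow> app (Rfib x) z = Tup [app x (base z), Num (height z)]"
  by (simp_all add: Rfib_def)

lemma Rpr_in_Hom: "x \<in> Hom Top_mtr U A \<Longrightarrow> Rpr x \<in> Hom Top_mtr (Rbr x) U"
  unfolding Rpr_def using Hom_Top_mtrD(1,3)[of x U A] continuous_map_base[of x]
  by (auto intro!: mk_map_in_Hom metrizable_Rbr)

lemma Rfib_in_Hom: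
  assumes x: "x \<in> Hom Top_mtr U Rnn"
  shows "Rfib x \<in> Hom Top_mtr (Rbr x) RF"
  unfolding Rfib_def
proof (intro mk_map_in_Hom metrizable_RF metrizable_Rbr)
  note [simp] = Hom_Top_mtrD(1)[OF x]
  show "metrizable_space (src x)" by (simp add: Hom_Top_mtrD[OF x])
  have "continuous_map (Rbr x) euclideanreal (\<lambda>z. num (app x (base z)))"
    using continuous_map_compose[OF continuous_map_base, of x euclideanreal "\<lambda>u. num (app x u)"]
      Hom_RnnD(1)[OF x] by (simp add: o_def)
  then show "continuous_map (Rbr x) RF (\<lambda>z. Tup [app x (base z), Num (height z)])"
    using Hom_RnnD(2,3)[OF x]
    by (auto simp: continuous_map_into_RF_iff continuous_map_height topspace_RF elim!: topspace_RbrE)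
      metis
qed

text \<open>A point of \<open>RF\<close> over \<open>app x u\<close> is determined by its height, which may be any number between
  \<open>0\<close> and \<open>app x u\<close>; hence a compatible pair of maps \<open>c\<close>, \<open>d\<close> amounts to the single map with
  components \<open>c\<close> and the height of \<open>d\<close>.\<close>

lemma pullback_Rbr:
  assumes x: "x \<in> Hom Top_mtr U Rnn"
  shows "is_pullback Top_mtr x Rp (Rbr x) (Rpr x) (Rfib x)"
proof -
  note xD [simp] = Hom_Top_mtrD(1)[OF x]
  note pr = Rpr_in_Hom[OF x] and fib = Rfib_in_Hom[OF x]
  have [simp]: "src Rp = RF" by (simp add: Rp_def)
  have app_Rp: "w \<in> topspace RF \<Longrightarrow> app Rp w = base w" for w by (simp add: Rp_def)
  have comm: "Comp Top_mtr x (Rpr x) = Comp Top_mtr Rp (Rfib x)"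
    by (rule Hom_Top_mtr_eqI[OF Comp_in_Hom_Top_mtr[OF pr x] Comp_in_Hom_Top_mtr[OF fib Rp_in_Hom]])
      (use Hom_Top_mtrD(6)[OF fib] in \<open>simp add: app_Rp\<close>)
  have "\<exists>!h. h \<in> Hom Top_mtr Q (Rbr x) \<and> Comp Top_mtr (Rpr x) h = c \<and> Comp Top_mtr (Rfib x) h = d"
    if c: "c \<in> Hom Top_mtr Q U" and d: "d \<in> Hom Top_mtr Q RF"
      and eq: "Comp Top_mtr x c = Comp Top_mtr Rp d" for Q c d
  proof (rule ex1I)
    note [simp] = Hom_Top_mtrD(1)[OF c] Hom_Top_mtrD(1)[OF d]
    define h where "h = mk_map Q (Rbr x) (\<lambda>q. Tup [app c q, Num (height (app d q))])"
    have dq: "\<exists>a. app d q = Tup [app x (app c q), Num a] \<and> 0 \<le> a \<and> a \<le> num (app x (app c q))"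
      if q: "q \<in> topspace Q" for q
      using eq[THEN arg_cong, of "\<lambda>f. app f q"] q Hom_Top_mtrD(6)[OF d q]
      by (auto simp: app_Rp topspace_RF)
    have inQ: "Tup [app c q, Num (height (app d q))] \<in> topspace (Rbr x)" if q: "q \<in> topspace Q" for q
      using dq[OF q] Hom_Top_mtrD(6)[OF c q] by auto
    have "continuous_map Q (Rbr x) (\<lambda>q. Tup [app c q, Num (height (app d q))])"
      using Hom_Top_mtrD(5)[OF c] Hom_Top_mtrD(5)[OF d] inQ
      by (auto simp: continuous_map_into_Rbr_iff continuous_map_into_RF_iff)
    then have h: "h \<in> Hom Top_mtr Q (Rbr x)"
      unfolding h_def using Hom_Top_mtrD(3)[OF c] Hom_Top_mtrD(3)[OF x]
      by (intro mk_map_in_Hom metrizable_Rbr) simp_all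
    have app_h: "app h q = Tup [app c q, Num (height (app d q))]" if "q \<in> topspace Q" for q
      using that by (simp add: h_def)
    have "Comp Top_mtr (Rpr x) h = c"
      by (rule Hom_Top_mtr_eqI[OF Comp_in_Hom_Top_mtr[OF h pr] c])
        (use inQ in \<open>simp add: app_h Hom_Top_mtrD(1)[OF h]\<close>)
    moreover have "Comp Top_mtr (Rfib x) h = d"
      by (rule Hom_Top_mtr_eqI[OF Comp_in_Hom_Top_mtr[OF h fib] d])
        (use inQ dq in \<open>fastforce simp: app_h Hom_Top_mtrD(1)[OF h]\<close>)
    ultimately show "h \<in> Hom Top_mtr Q (Rbr x) \<and> Comp Top_mtr (Rpr x) h = c \<and> Comp Top_mtr (Rfib x) h = d"
      using h by blast
    fix h' assume h': "h' \<in> Hom Top_mtr Q (Rbr x) \<and> Comp Top_mtr (Rpr x) h' = c \<and> Comp Top_mtr (Rfib x) h' = d"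
    then have h'H: "h' \<in> Hom Top_mtr Q (Rbr x)" by simp
    show "h' = h"
    proof (rule Hom_Top_mtr_eqI[OF h'H h])
      fix q assume q: "q \<in> topspace Q"
      have "app h' q \<in> topspace (Rbr x)" "src h' = Q"
        using Hom_Top_mtrD[OF h'H] q by auto
      with h' q show "app h' q = app h q"
        unfolding app_h[OF q] by (auto elim!: topspace_RbrE)
    qed
  qed
  then show ?thesis
    unfolding is_pullback_def using pr fib comm Hom_Top_mtrD(3)[OF x]
    by (simp add: metrizable_Rbr)
qed

lemma adder_base:
  "dependent_adder_base (Top_mtr :: ('v point topology, 'v map) cat)
    one_space Rnn RF Rp Runit Rbr Rpr Rfib"
  by (intro dependent_adder_base.intro dependent_adder_base_axioms.intro category_Top_mtr
      finite_limits_Top_mtr terminal_one_space Rp_in_Hom Runit_in_Hom pullback_Rbr)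
    (simp_all add: metrizable_Rnn)

section \<open>Unit, lift and switch as explicit maps\<close>

interpretation mtr: dependent_adder_base "Top_mtr :: ('v point topology, 'v map) cat"
    one_space Rnn RF Rp Runit Rbr Rpr Rfib
  by (rule adder_base)

lemma const_unit_eq:
  fixes X :: "'v point topology"
  assumes X: "metrizable_space X"
  shows "mtr.const_unit X = mk_map X Rnn (\<lambda>_. Num 1)"
proof -
  have "(THE t. t \<in> Hom Top_mtr X one_space) = mk_map X one_space (\<lambda>_. Tup [])"
    using mk_map_one_space[OF X] Hom_one_space_unique by (rule the_equality)
  moreover have "(Tup [Num 1, Num 1] :: 'v point) \<in> topspace RF" "(Tup [] :: 'v point) \<in> topspace one_space"
    by (auto simp: topspace_RF one_space_def)
  ultimately show ?thesis
    unfolding mtr.const_unit_def mtr.unitA_def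
    by (simp add: Comp_Top_mtr Rp_def Runit_def) (auto intro!: mk_map_cong)
qed

lemma const_unit_in_Hom: "metrizable_space X \<Longrightarrow> mtr.const_unit X \<in> Hom Top_mtr X Rnn"
  unfolding const_unit_eq by (intro mk_map_in_Hom_Rnn) simp_all

text \<open>The abstract description of \<open>h \<times>\<^sub>A id\<^sub>F\<close> is turned into a formula, in order that the axioms
  become identities between integrals: the two projections of a point of \<open>Rbr y\<close> fix its base and
  its height, and hence the point. The switch map is treated likewise.\<close>

lemma lift_eq:
  assumes h: "h \<in> Hom Top_mtr U U'" and y: "y \<in> Hom Top_mtr U' Rnn"
  shows "mtr.lift h y =
    mk_map (Rbr (Comp Top_mtr y h)) (Rbr y) (\<lambda>z. Tup [app h (base z), Num (height z)])" (is "_ = ?k")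
proof -
  let ?yh = "Comp Top_mtr y h"
  note [simp] = Hom_Top_mtrD(1)[OF h] Hom_Top_mtrD(1)[OF y]
  have yh: "?yh \<in> Hom Top_mtr U Rnn" by (rule Comp_in_Hom_Top_mtr[OF h y])
  have mem: "Tup [app h (base z), Num (height z)] \<in> topspace (Rbr y)" if "z \<in> topspace (Rbr ?yh)" for z
    using that Hom_Top_mtrD(6)[OF h] by (auto elim!: topspace_RbrE)
  have "continuous_map (Rbr ?yh) U' (\<lambda>z. app h (base z))"
    using continuous_map_compose[OF continuous_map_base, of ?yh U' "app h"] Hom_Top_mtrD(5)[OF h]
    by (simp add: o_def)
  then have "continuous_map (Rbr ?yh) (Rbr y) (\<lambda>z. Tup [app h (base z), Num (height z)])"
    using mem by (simp add: continuous_map_into_Rbr_iff continuous_map_height)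
  then have k: "?k \<in> Hom Top_mtr (Rbr ?yh) (Rbr y)"
    using Hom_Top_mtrD(3)[OF h] Hom_Top_mtrD(3)[OF y] by (intro mk_map_in_Hom metrizable_Rbr) simp_all
  show ?thesis
    unfolding mtr.lift_def
  proof (rule the_equality, intro conjI)
    show "?k \<in> Hom Top_mtr (Rbr ?yh) (Rbr y)" by (rule k)
    show "Comp Top_mtr (Rpr y) ?k = Comp Top_mtr h (Rpr ?yh)"
      by (rule Hom_Top_mtr_eqI[OF Comp_in_Hom_Top_mtr[OF k Rpr_in_Hom[OF y]]
            Comp_in_Hom_Top_mtr[OF Rpr_in_Hom[OF yh] h]])
        (use mem in simp)
    show "Comp Top_mtr (Rfib y) ?k = Rfib ?yh"
      by (rule Hom_Top_mtr_eqI[OF Comp_in_Hom_Top_mtr[OF k Rfib_in_Hom[OF y]] Rfib_in_Hom[OF yh]])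
        (use mem in \<open>auto elim!: topspace_RbrE\<close>)
    fix k' assume k': "k' \<in> Hom Top_mtr (Rbr ?yh) (Rbr y) \<and>
      Comp Top_mtr (Rpr y) k' = Comp Top_mtr h (Rpr ?yh) \<and> Comp Top_mtr (Rfib y) k' = Rfib ?yh"
    then have k'H: "k' \<in> Hom Top_mtr (Rbr ?yh) (Rbr y)" by simp
    show "k' = ?k"
    proof (rule Hom_Top_mtr_eqI[OF k'H k])
      fix z assume z: "z \<in> topspace (Rbr ?yh)"
      have k'z: "app k' z \<in> topspace (Rbr y)" "src k' = Rbr ?yh"
        using Hom_Top_mtrD[OF k'H] z by auto
      have "app (Comp Top_mtr (Rpr y) k') z = app (Comp Top_mtr h (Rpr ?yh)) z"
        and "app (Comp Top_mtr (Rfib y) k') z = app (Rfib ?yh) z"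
        using k' by simp_all
      then have "base (app k' z) = app h (base z)" "height (app k' z) = height z"
        using k'z z by simp_all
      then show "app k' z = app ?k z"
        using z topspace_Rbr_eqI[OF k'z(1) mem[OF z]] by simp
    qed
  qed
qed

lemma switch_eq:
  assumes x: "x \<in> Hom Top_mtr U Rnn" and y: "y \<in> Hom Top_mtr U Rnn"
  shows "mtr.switch x y = mk_map (Rbr (Comp Top_mtr y (Rpr x))) (Rbr (Comp Top_mtr x (Rpr y)))
    (\<lambda>z. Tup [Tup [base (base z), Num (height z)], Num (height (base z))])" (is "_ = mk_map ?D ?E ?s")
proof -
  note [simp] = Hom_Top_mtrD(1)[OF x] Hom_Top_mtrD(1)[OF y]
  have ypx: "Comp Top_mtr y (Rpr x) \<in> Hom Top_mtr (Rbr x) Rnn"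
    and xpy: "Comp Top_mtr x (Rpr y) \<in> Hom Top_mtr (Rbr y) Rnn"
    by (rule Comp_in_Hom_Top_mtr[OF Rpr_in_Hom[OF x] y] Comp_in_Hom_Top_mtr[OF Rpr_in_Hom[OF y] x])+
  have memx: "base z \<in> topspace (Rbr x)" if "z \<in> topspace ?D" for z
    using that by (auto elim!: topspace_RbrE)
  have memy: "Tup [base (base z), Num (height z)] \<in> topspace (Rbr y)" if "z \<in> topspace ?D" for z
    using that by (auto elim!: topspace_RbrE)
  have mem: "?s z \<in> topspace ?E" if "z \<in> topspace ?D" for z
    using that by (auto elim!: topspace_RbrE)
  have b: "continuous_map ?D (Rbr x) base"
    using continuous_map_base[of "Comp Top_mtr y (Rpr x)"] by simp
  have bb: "continuous_map ?D U (\<lambda>z. base (base z))"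
    using continuous_map_compose[OF b continuous_map_base] by (simp add: o_def)
  have hb: "continuous_map ?D euclideanreal (\<lambda>z. height (base z))"
    using continuous_map_compose[OF b continuous_map_height] by (simp add: o_def)
  have "continuous_map ?D (Rbr y) (\<lambda>z. Tup [base (base z), Num (height z)])"
    using bb memy by (simp add: continuous_map_into_Rbr_iff continuous_map_height)
  then have "continuous_map ?D ?E ?s"
    using hb mem by (simp add: continuous_map_into_Rbr_iff)
  then have k: "mk_map ?D ?E ?s \<in> Hom Top_mtr ?D ?E"
    using Hom_Top_mtrD(3)[OF x] by (intro mk_map_in_Hom metrizable_Rbr) (simp_all add: metrizable_Rbr)
  note prE = Rpr_in_Hom[OF xpy] and prD = Rpr_in_Hom[OF ypx]
  show ?thesis
    unfolding mtr.switch_def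
  proof (rule the_equality, intro conjI)
    show "mk_map ?D ?E ?s \<in> Hom Top_mtr ?D ?E" by (rule k)
    show "Comp Top_mtr (Rpr y) (Comp Top_mtr (Rpr (Comp Top_mtr x (Rpr y))) (mk_map ?D ?E ?s)) =
        Comp Top_mtr (Rpr x) (Rpr (Comp Top_mtr y (Rpr x)))"
      by (rule Hom_Top_mtr_eqI[OF Comp_in_Hom_Top_mtr[OF Comp_in_Hom_Top_mtr[OF k prE] Rpr_in_Hom[OF y]]
            Comp_in_Hom_Top_mtr[OF prD Rpr_in_Hom[OF x]]])
        (use mem memx memy in \<open>simp del: mem_topspace_Rbr\<close>)
    show "Comp Top_mtr (Rfib (Comp Top_mtr x (Rpr y))) (mk_map ?D ?E ?s) =
        Comp Top_mtr (Rfib x) (Rpr (Comp Top_mtr y (Rpr x)))"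
      by (rule Hom_Top_mtr_eqI[OF Comp_in_Hom_Top_mtr[OF k Rfib_in_Hom[OF xpy]]
            Comp_in_Hom_Top_mtr[OF prD Rfib_in_Hom[OF x]]])
        (use mem memx memy in \<open>simp del: mem_topspace_Rbr\<close>)
    show "Comp Top_mtr (Rfib y) (Comp Top_mtr (Rpr (Comp Top_mtr x (Rpr y))) (mk_map ?D ?E ?s)) =
        Rfib (Comp Top_mtr y (Rpr x))"
      by (rule Hom_Top_mtr_eqI[OF Comp_in_Hom_Top_mtr[OF Comp_in_Hom_Top_mtr[OF k prE] Rfib_in_Hom[OF y]]
            Rfib_in_Hom[OF ypx]])
        (use mem memx memy in \<open>simp del: mem_topspace_Rbr\<close>)
    fix k' assume k': "k' \<in> Hom Top_mtr ?D ?E \<and>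
      Comp Top_mtr (Rpr y) (Comp Top_mtr (Rpr (Comp Top_mtr x (Rpr y))) k') =
        Comp Top_mtr (Rpr x) (Rpr (Comp Top_mtr y (Rpr x))) \<and>
      Comp Top_mtr (Rfib (Comp Top_mtr x (Rpr y))) k' =
        Comp Top_mtr (Rfib x) (Rpr (Comp Top_mtr y (Rpr x))) \<and>
      Comp Top_mtr (Rfib y) (Comp Top_mtr (Rpr (Comp Top_mtr x (Rpr y))) k') =
        Rfib (Comp Top_mtr y (Rpr x))"
    then have k'H: "k' \<in> Hom Top_mtr ?D ?E" by simp
    show "k' = mk_map ?D ?E ?s"
    proof (rule Hom_Top_mtr_eqI[OF k'H k])
      fix z assume z: "z \<in> topspace ?D"
      have k'z: "app k' z \<in> topspace ?E" "src k' = ?D"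
        using Hom_Top_mtrD[OF k'H] z by auto
      then have bk'z: "base (app k' z) \<in> topspace (Rbr y)"
        by (auto elim!: topspace_RbrE)
      have "app (Comp Top_mtr (Rpr y) (Comp Top_mtr (Rpr (Comp Top_mtr x (Rpr y))) k')) z =
          app (Comp Top_mtr (Rpr x) (Rpr (Comp Top_mtr y (Rpr x)))) z"
        and "app (Comp Top_mtr (Rfib (Comp Top_mtr x (Rpr y))) k') z =
          app (Comp Top_mtr (Rfib x) (Rpr (Comp Top_mtr y (Rpr x)))) z"
        and "app (Comp Top_mtr (Rfib y) (Comp Top_mtr (Rpr (Comp Top_mtr x (Rpr y))) k')) z =
          app (Rfib (Comp Top_mtr y (Rpr x))) z"
        using k' by simp_all
      then have "base (base (app k' z)) = base (base z)" "height (app k' z) = height (base z)"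
        "height (base (app k' z)) = height z"
        using k'z bk'z z memx[OF z] by simp_all
      moreover from this have "base (app k' z) = Tup [base (base z), Num (height z)]"
        by (intro topspace_Rbr_eqI[OF bk'z memy[OF z]]) simp_all
      ultimately have "app k' z = ?s z"
        by (intro topspace_Rbr_eqI[OF k'z(1) mem[OF z]]) simp_all
      then show "app k' z = app (mk_map ?D ?E ?s) z"
        using z by simp
    qed
  qed
qed

section \<open>Sum and flattening are morphisms\<close>

text \<open>The sum is the case where \<open>w\<close> is the identity and \<open>c\<close> the full length \<open>x\<close> of the fibre.
  Flattening needs the integral up to a height \<open>a\<close> inside the fibre, where \<open>w\<close> and \<open>c\<close> read off
  \<open>u\<close> and \<open>a\<close> from the point \<open>(u, a, b)\<close>.\<close>

lemma continuous_map_fibre_integral: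
  assumes x: "x \<in> Hom Top_mtr U Rnn" and f: "f \<in> Hom Top_mtr (Rbr x) Rnn"
    and w: "continuous_map Z U w" and c: "continuous_map Z euclideanreal c"
    and c_bounds: "\<And>z. z \<in> topspace Z \<Longrightarrow> 0 \<le> c z \<and> c z \<le> num (app x (w z))"
  shows "continuous_map Z euclideanreal (\<lambda>z. integral {0..c z} (\<lambda>t. num (app f (Tup [w z, Num t]))))"
proof (rule continuous_map_integral_upto[OF c])
  note [simp] = Hom_Top_mtrD(1)[OF x]
  let ?S = "subtopology (prod_topology Z euclideanreal) {(z, t). 0 \<le> t \<and> t \<le> c z}"
  have wS: "w z \<in> topspace U" if "z \<in> topspace Z" for z
    using continuous_map_funspace[OF w] that by auto
  have memS: "Tup [w (fst s), Num (snd s)] \<in> topspace (Rbr x)" if "s \<in> topspace ?S" for s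
  proof -
    from that have "fst s \<in> topspace Z" "0 \<le> snd s" "snd s \<le> c (fst s)" by auto
    with wS c_bounds[of "fst s"] show ?thesis by simp
  qed
  have "continuous_map ?S U (\<lambda>s. w (fst s))"
    using continuous_map_compose[OF continuous_map_subtopology_fst w] by (simp add: o_def)
  then have "continuous_map ?S (Rbr x) (\<lambda>s. Tup [w (fst s), Num (snd s)])"
    using continuous_map_subtopology_snd[of Z euclideanreal "{(z, t). 0 \<le> t \<and> t \<le> c z}"] memS
    by (simp add: continuous_map_into_Rbr_iff del: mem_topspace_Rbr)
  from continuous_map_compose[OF this Hom_RnnD(1)[OF f]]
  show "continuous_map ?S euclideanreal (\<lambda>(z, t). num (app f (Tup [w z, Num t])))"
    by (simp add: o_def case_prod_unfold)
qed (simp add: c_bounds)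

lemma continuous_on_fibre:
  assumes x: "x \<in> Hom Top_mtr U Rnn" and f: "f \<in> Hom Top_mtr (Rbr x) Rnn" and u: "u \<in> topspace U"
  shows "continuous_on {0..num (app x u)} (\<lambda>t. num (app f (Tup [u, Num t])))"
proof -
  note [simp] = Hom_Top_mtrD(1)[OF x]
  have "continuous_map (top_of_set {0..num (app x u)}) (Rbr x) (\<lambda>t. Tup [u, Num t])"
    using u by (simp add: continuous_map_into_Rbr_iff)
  from continuous_map_compose[OF this Hom_RnnD(1)[OF f]] show ?thesis
    by (simp add: o_def)
qed

lemma fibre_nonneg:
  assumes x: "x \<in> Hom Top_mtr U Rnn" and f: "f \<in> Hom Top_mtr (Rbr x) Rnn"
    and "u \<in> topspace U" "0 \<le> t" "t \<le> num (app x u)"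
  shows "0 \<le> num (app f (Tup [u, Num t]))"
  using assms(3-5) Hom_Top_mtrD(1)[OF x] by (intro Hom_RnnD(2)[OF f]) simp

text \<open>The second conclusion keeps the values of the flattening map inside the fibre of the sum;
  it relies on the integrand being nonnegative.\<close>

lemma fibre_integral_mono:
  assumes x: "x \<in> Hom Top_mtr U Rnn" and f: "f \<in> Hom Top_mtr (Rbr x) Rnn"
    and u: "u \<in> topspace U" and a: "0 \<le> a" "a \<le> b" "b \<le> num (app x u)"
  shows "0 \<le> integral {0..a} (\<lambda>t. num (app f (Tup [u, Num t])))"
    and "integral {0..a} (\<lambda>t. num (app f (Tup [u, Num t]))) \<le> integral {0..b} (\<lambda>t. num (app f (Tup [u, Num t])))"
proof -
  let ?F = "\<lambda>t. num (app f (Tup [u, Num t]))"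
  have int: "?F integrable_on {0..c}" if "c \<le> num (app x u)" for c
    using that by (intro integrable_continuous_interval continuous_on_subset[OF continuous_on_fibre[OF x f u]]) simp
  show "0 \<le> integral {0..a} ?F"
    using a by (intro integral_nonneg int fibre_nonneg[OF x f u]) simp_all
  show "integral {0..a} ?F \<le> integral {0..b} ?F"
    using a by (intro integral_subset_le int ballI fibre_nonneg[OF x f u]) simp_all
qed

lemma Rsum_in_Hom:
  assumes x: "x \<in> Hom Top_mtr U Rnn" and f: "f \<in> Hom Top_mtr (Rbr x) Rnn"
  shows "Rsum x f \<in> Hom Top_mtr U Rnn"
  unfolding Rsum_def Hom_Top_mtrD(1)[OF x]
proof (rule mk_map_in_Hom_Rnn)
  show "continuous_map U euclideanreal (\<lambda>u. integral {0..num (app x u)} (\<lambda>t. num (app f (Tup [u, Num t]))))"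
    using Hom_RnnD(2)[OF x] continuous_map_id[of U, unfolded id_def]
    by (intro continuous_map_fibre_integral[OF x f _ Hom_RnnD(1)[OF x]]) auto
qed (auto simp: Hom_Top_mtrD(3)[OF x] Hom_RnnD(2)[OF x] intro!: fibre_integral_mono(1)[OF x f _ _ order.refl])

lemma num_app_Rsum [simp]:
  "u \<in> topspace (src x) \<Longrightarrow>
    num (app (Rsum x f) u) = integral {0..num (app x u)} (\<lambda>t. num (app f (Tup [u, Num t])))"
  by (simp add: Rsum_def)

lemma src_Rsum [simp]: "src (Rsum x f) = src x"
  by (simp add: Rsum_def)

lemma Rflat_simps [simp]:
  "src (Rflat x f) = Rbr f"
  "Tup [Tup [u, Num a], Num b] \<in> topspace (Rbr f) \<Longrightarrow>
    app (Rflat x f) (Tup [Tup [u, Num a], Num b]) = Tup [u, Num (integral {0..a} (\<lambda>t. num (app f (Tup [u, Num t]))))]"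
  by (simp_all add: Rflat_def Let_def del: mem_topspace_Rbr)

lemma Rflat_in_Hom:
  assumes x: "x \<in> Hom Top_mtr U Rnn" and f: "f \<in> Hom Top_mtr (Rbr x) Rnn"
  shows "Rflat x f \<in> Hom Top_mtr (Rbr f) (Rbr (Rsum x f))"
proof -
  note [simp] = Hom_Top_mtrD(1)[OF x] Hom_Top_mtrD(1)[OF f]
  let ?I = "\<lambda>z. integral {0..height (base z)} (\<lambda>t. num (app f (Tup [base (base z), Num t])))"
  have b: "continuous_map (Rbr f) (Rbr x) base"
    using continuous_map_base[of f] by simp
  have bb: "continuous_map (Rbr f) U (\<lambda>z. base (base z))"
    using continuous_map_compose[OF b continuous_map_base] by (simp add: o_def)
  have hb: "continuous_map (Rbr f) euclideanreal (\<lambda>z. height (base z))"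
    using continuous_map_compose[OF b continuous_map_height] by (simp add: o_def)
  have "continuous_map (Rbr f) euclideanreal ?I"
    by (intro continuous_map_fibre_integral[OF x f bb hb]) (auto elim!: topspace_RbrE)
  moreover have "Tup [base (base z), Num (?I z)] \<in> topspace (Rbr (Rsum x f))" if "z \<in> topspace (Rbr f)" for z
    using that fibre_integral_mono[OF x f] by (auto elim!: topspace_RbrE)
  ultimately have "continuous_map (Rbr f) (Rbr (Rsum x f)) (\<lambda>z. Tup [base (base z), Num (?I z)])"
    using bb by (simp add: continuous_map_into_Rbr_iff del: mem_topspace_Rbr)
  then show ?thesis
    unfolding Rflat_def Let_def using Hom_Top_mtrD(3)[OF x]
    by (intro mk_map_in_Hom metrizable_Rbr) (simp_all add: metrizable_Rbr)
qed

section \<open>The axioms\<close>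

lemma Rsum_natural:
  assumes h: "h \<in> Hom Top_mtr U U'" and y: "y \<in> Hom Top_mtr U' Rnn" and g: "g \<in> Hom Top_mtr (Rbr y) Rnn"
  shows "Rsum (Comp Top_mtr y h) (Comp Top_mtr g (mtr.lift h y)) = Comp Top_mtr (Rsum y g) h"
proof -
  note [simp] = Hom_Top_mtrD(1)[OF h] Hom_Top_mtrD(1)[OF y] Hom_Top_mtrD(2)[OF g]
  show ?thesis
    unfolding lift_eq[OF h y] Rsum_def Comp_Top_mtr
    by (auto simp: Comp_Top_mtr[symmetric] Hom_Top_mtrD(6)[OF h] intro!: mk_map_cong integral_cong)
qed

lemma Rflat_over:
  assumes x: "x \<in> Hom Top_mtr U Rnn" and f: "f \<in> Hom Top_mtr (Rbr x) Rnn"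
  shows "Comp Top_mtr (Rpr (Rsum x f)) (Rflat x f) = Comp Top_mtr (Rpr x) (Rpr f)"
proof (rule Hom_Top_mtr_eqI)
  show "Comp Top_mtr (Rpr (Rsum x f)) (Rflat x f) \<in> Hom Top_mtr (Rbr f) U"
    by (rule Comp_in_Hom_Top_mtr[OF Rflat_in_Hom[OF x f] Rpr_in_Hom[OF Rsum_in_Hom[OF x f]]])
  show "Comp Top_mtr (Rpr x) (Rpr f) \<in> Hom Top_mtr (Rbr f) U"
    by (rule Comp_in_Hom_Top_mtr[OF Rpr_in_Hom[OF f] Rpr_in_Hom[OF x]])
  fix z assume z: "z \<in> topspace (Rbr f)"
  then have "app (Rflat x f) z \<in> topspace (Rbr (Rsum x f))"
    by (rule Hom_Top_mtrD(6)[OF Rflat_in_Hom[OF x f]])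
  then show "app (Comp Top_mtr (Rpr (Rsum x f)) (Rflat x f)) z = app (Comp Top_mtr (Rpr x) (Rpr f)) z"
    using z Hom_Top_mtrD(1)[OF f]
    by (auto elim!: topspace_RbrE[of z] topspace_RbrE[of _ x])
qed

lemma Rsum_right_unit:
  assumes x: "x \<in> Hom Top_mtr U Rnn"
  shows "Rsum x (mtr.const_unit (Rbr x)) = x"
proof -
  have mR: "metrizable_space (Rbr x)"
    using Hom_Top_mtrD(1,3)[OF x] by (simp add: metrizable_Rbr)
  show ?thesis
  proof (rule Hom_Rnn_eqI[OF Rsum_in_Hom[OF x const_unit_in_Hom[OF mR]] x])
    fix u assume u: "u \<in> topspace U"
    have "integral {0..num (app x u)} (\<lambda>t. num (app (mtr.const_unit (Rbr x)) (Tup [u, Num t]))) =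
        integral {0..num (app x u)} (\<lambda>_. 1)"
      using u Hom_Top_mtrD(1)[OF x] by (intro integral_cong) (simp add: const_unit_eq[OF mR])
    then show "num (app (Rsum x (mtr.const_unit (Rbr x))) u) = num (app x u)"
      using u Hom_Top_mtrD(1)[OF x] Hom_RnnD(2)[OF x u] by simp
  qed
qed

text \<open>Flattening the constant \<open>1\<close> gives \<open>(u, a, b) \<mapsto> (u, a)\<close> since the integral of \<open>1\<close> from \<open>0\<close> to
  \<open>a\<close> is \<open>a\<close>; thus \<open>f\<close> is averaged over a unit interval on which it does not vary.\<close>

lemma Rsum_left_unit:
  assumes x: "x \<in> Hom Top_mtr U Rnn" and f: "f \<in> Hom Top_mtr (Rbr x) Rnn"
  shows "Rsum (mtr.const_unit (Rbr x)) (Comp Top_mtr f (Rflat x (mtr.const_unit (Rbr x)))) = f"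
proof -
  let ?c = "mtr.const_unit (Rbr x)"
  have mR: "metrizable_space (Rbr x)"
    by (rule Hom_Top_mtrD(3)[OF f])
  note c = const_unit_in_Hom[OF mR]
  have fl: "Rflat x ?c \<in> Hom Top_mtr (Rbr ?c) (Rbr x)"
    using Rflat_in_Hom[OF x c] by (simp add: Rsum_right_unit[OF x])
  show ?thesis
  proof (rule Hom_Rnn_eqI[OF Rsum_in_Hom[OF c Comp_in_Hom_Top_mtr[OF fl f]] f])
    fix z assume z: "z \<in> topspace (Rbr x)"
    then obtain u a where z_eq: "z = Tup [u, Num a]" and u: "u \<in> topspace U" and a: "0 \<le> a" "a \<le> num (app x u)"
      using Hom_Top_mtrD(1)[OF x] by (auto elim!: topspace_RbrE)
    have cz: "app ?c z = Num 1" and src_c: "src ?c = Rbr x"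
      using z by (simp_all add: const_unit_eq[OF mR])
    have "integral {0..a} (\<lambda>t. num (app ?c (Tup [u, Num t]))) = integral {0..a} (\<lambda>_. 1)"
      using u a Hom_Top_mtrD(1)[OF x] by (intro integral_cong) (simp add: const_unit_eq[OF mR])
    then have fl_z: "app (Rflat x ?c) (Tup [z, Num t]) = z" if "t \<in> {0..1}" for t
      using that z a cz src_c unfolding z_eq by simp
    have "integral {0..1} (\<lambda>t. num (app (Comp Top_mtr f (Rflat x ?c)) (Tup [z, Num t]))) =
        integral {0..1::real} (\<lambda>_. num (app f z))"
      using z cz src_c by (intro integral_cong) (simp add: fl_z)
    then show "num (app (Rsum ?c (Comp Top_mtr f (Rflat x ?c))) z) = num (app f z)"
      using z cz src_c by simp
  qed
qed

text \<open>The common core of both associativity axioms: on the fibre over \<open>(u, t)\<close> the integrand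
  \<open>g \<circ> f\<^sup>\<flat>\<close> does not depend on the second height, because flattening discards it. The case of the
  full length \<open>a = x u\<close> is sum associativity, and a general \<open>a\<close> gives the height component in
  flatten associativity.\<close>

lemma fibre_integral_assoc:
  assumes x: "x \<in> Hom Top_mtr U Rnn" and f: "f \<in> Hom Top_mtr (Rbr x) Rnn"
    and g: "g \<in> Hom Top_mtr (Rbr (Rsum x f)) Rnn"
    and u: "u \<in> topspace U" and a: "0 \<le> a" "a \<le> num (app x u)"
  shows "integral {0..integral {0..a} (\<lambda>t. num (app f (Tup [u, Num t])))} (\<lambda>s. num (app g (Tup [u, Num s]))) =
    integral {0..a} (\<lambda>t. num (app (Rsum f (Comp Top_mtr g (Rflat x f))) (Tup [u, Num t])))"
proof -
  note [simp] = Hom_Top_mtrD(1)[OF x] Hom_Top_mtrD(1)[OF f]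
  let ?F = "\<lambda>t. num (app f (Tup [u, Num t]))" and ?G = "\<lambda>s. num (app g (Tup [u, Num s]))"
  have "integral {0..a} (\<lambda>t. num (app (Rsum f (Comp Top_mtr g (Rflat x f))) (Tup [u, Num t]))) =
      integral {0..a} (\<lambda>t. integral {0..?F t} (\<lambda>_. ?G (integral {0..t} ?F)))"
  proof (rule integral_cong)
    fix t assume t: "t \<in> {0..a}"
    have "integral {0..?F t} (\<lambda>b. num (app (Comp Top_mtr g (Rflat x f)) (Tup [Tup [u, Num t], Num b]))) =
        integral {0..?F t} (\<lambda>_. ?G (integral {0..t} ?F))"
      using u a t by (intro integral_cong) simp
    then show "num (app (Rsum f (Comp Top_mtr g (Rflat x f))) (Tup [u, Num t])) =
        integral {0..?F t} (\<lambda>_. ?G (integral {0..t} ?F))"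
      using u a t by simp
  qed
  also have "\<dots> = integral {0..integral {0..a} ?F} ?G"
  proof (rule integral_substitution_primitive)
    show "continuous_on {0..a} ?F"
      using a by (intro continuous_on_subset[OF continuous_on_fibre[OF x f u]]) simp
    show "continuous_on {0..integral {0..a} ?F} ?G"
      using a u fibre_integral_mono(2)[OF x f u a order.refl]
      by (intro continuous_on_subset[OF continuous_on_fibre[OF Rsum_in_Hom[OF x f] g u]]) simp
  qed (use a fibre_nonneg[OF x f u] in auto)
  finally show ?thesis by simp
qed

lemma Rsum_assoc:
  assumes x: "x \<in> Hom Top_mtr U Rnn" and f: "f \<in> Hom Top_mtr (Rbr x) Rnn"
    and g: "g \<in> Hom Top_mtr (Rbr (Rsum x f)) Rnn"
  shows "Rsum (Rsum x f) g = Rsum x (Rsum f (Comp Top_mtr g (Rflat x f)))"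
proof (rule Hom_Rnn_eqI)
  show "Rsum (Rsum x f) g \<in> Hom Top_mtr U Rnn"
    by (rule Rsum_in_Hom[OF Rsum_in_Hom[OF x f] g])
  show "Rsum x (Rsum f (Comp Top_mtr g (Rflat x f))) \<in> Hom Top_mtr U Rnn"
    by (rule Rsum_in_Hom[OF x Rsum_in_Hom[OF f Comp_in_Hom_Top_mtr[OF Rflat_in_Hom[OF x f] g]]])
  fix u assume u: "u \<in> topspace U"
  then show "num (app (Rsum (Rsum x f) g) u) = num (app (Rsum x (Rsum f (Comp Top_mtr g (Rflat x f)))) u)"
    using fibre_integral_assoc[OF x f g u Hom_RnnD(2)[OF x u] order.refl] Hom_Top_mtrD(1)[OF x] by simp
qed

text \<open>At \<open>(((u, a), b), c)\<close> both sides are \<open>(u, I)\<close> for the two integrals \<open>I\<close> identified by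
  \<open>fibre_integral_assoc\<close>; \<open>b\<close> and \<open>c\<close> drop out. Sum associativity enters as well, to make the
  codomains agree.\<close>

lemma Rflat_assoc:
  assumes x: "x \<in> Hom Top_mtr U Rnn" and f: "f \<in> Hom Top_mtr (Rbr x) Rnn"
    and g: "g \<in> Hom Top_mtr (Rbr (Rsum x f)) Rnn"
  shows "Comp Top_mtr (Rflat (Rsum x f) g) (mtr.lift (Rflat x f) g) =
    Comp Top_mtr (Rflat x (Rsum f (Comp Top_mtr g (Rflat x f)))) (Rflat f (Comp Top_mtr g (Rflat x f)))"
proof -
  let ?gf = "Comp Top_mtr g (Rflat x f)"
  note [simp] = Hom_Top_mtrD(1)[OF x] Hom_Top_mtrD(1)[OF f] Hom_Top_mtrD(1)[OF g]
  note fl = Rflat_in_Hom[OF x f]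
  note gf = Comp_in_Hom_Top_mtr[OF fl g]
  have [simp]: "trg (Rflat (Rsum x f) g) = trg (Rflat x (Rsum f ?gf))"
    by (simp add: Rflat_def Rsum_assoc[OF x f g])
  show ?thesis
    unfolding lift_eq[OF fl g] Comp_Top_mtr[of "Rflat (Rsum x f) g"] Comp_Top_mtr[of "Rflat x (Rsum f ?gf)"]
  proof (simp del: mem_topspace_Rbr, rule mk_map_cong)
    fix z assume z: "z \<in> topspace (Rbr ?gf)"
    then obtain u a b c where z_eq: "z = Tup [Tup [Tup [u, Num a], Num b], Num c]"
      and u: "u \<in> topspace U" and a: "0 \<le> a" "a \<le> num (app x u)"
      by (auto elim!: topspace_RbrE)
    have flz: "app (Rflat f ?gf) z \<in> topspace (Rbr (Rsum f ?gf))"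
      by (rule Hom_Top_mtrD(6)[OF Rflat_in_Hom[OF f gf] z])
    let ?I = "integral {0..a} (\<lambda>t. num (app f (Tup [u, Num t])))"
    have fl_bz: "app (Rflat x f) (base z) = Tup [u, Num ?I]"
      using z unfolding z_eq by simp
    then have mem: "Tup [Tup [u, Num ?I], Num c] \<in> topspace (Rbr g)"
      using z Hom_Top_mtrD(6)[OF fl, of "base z"] unfolding z_eq by auto
    have fl_z: "app (Rflat f ?gf) z =
        Tup [Tup [u, Num a], Num (integral {0..b} (\<lambda>t. num (app ?gf (Tup [Tup [u, Num a], Num t]))))]"
      using z unfolding z_eq by (rule Rflat_simps(2))
    have "app (mk_map (Rbr ?gf) (Rbr g) (\<lambda>z. Tup [app (Rflat x f) (base z), Num (height z)])) z =
        Tup [Tup [u, Num ?I], Num c]"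
      using z fl_bz by (simp add: z_eq del: mem_topspace_Rbr)
    then show "app (Rflat (Rsum x f) g)
          (app (mk_map (Rbr ?gf) (Rbr g) (\<lambda>z. Tup [app (Rflat x f) (base z), Num (height z)])) z) =
        app (Rflat x (Rsum f ?gf)) (app (Rflat f ?gf) z)"
      using Rflat_simps(2)[OF mem, of "Rsum x f"] Rflat_simps(2)[OF flz[unfolded fl_z], of x]
        fibre_integral_assoc[OF x f g u a]
      by (simp only: fl_z)
  qed
qed

text \<open>Fubini's theorem for the continuous function \<open>\<phi>\<close> on the rectangle with sides \<open>y u\<close> and
  \<open>x u\<close>. The lengths \<open>x u\<close> and \<open>y u\<close> depend on \<open>u\<close> only, so the domain of integration is indeed a
  rectangle.\<close>

lemma Rsum_commute:
  assumes x: "x \<in> Hom Top_mtr U Rnn" and y: "y \<in> Hom Top_mtr U Rnn"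
    and f: "f \<in> Hom Top_mtr (Rbr (Comp Top_mtr x (Rpr y))) Rnn"
  shows "Rsum y (Rsum (Comp Top_mtr x (Rpr y)) f) =
    Rsum x (Rsum (Comp Top_mtr y (Rpr x)) (Comp Top_mtr f (mtr.switch x y)))"
proof -
  let ?xy = "Comp Top_mtr x (Rpr y)" and ?yx = "Comp Top_mtr y (Rpr x)"
  note [simp] = Hom_Top_mtrD(1)[OF x] Hom_Top_mtrD(1)[OF y] Hom_Top_mtrD(2)[OF f]
  note xy = Comp_in_Hom_Top_mtr[OF Rpr_in_Hom[OF y] x] and yx = Comp_in_Hom_Top_mtr[OF Rpr_in_Hom[OF x] y]
  show ?thesis
    unfolding Rsum_def[of y] Rsum_def[of x] Hom_Top_mtrD(1)[OF x] Hom_Top_mtrD(1)[OF y]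
  proof (rule mk_map_cong, rule arg_cong[of _ _ Num])
    fix u assume u: "u \<in> topspace U"
    let ?X = "num (app x u)" and ?Y = "num (app y u)"
    let ?\<phi> = "\<lambda>s t. num (app f (Tup [Tup [u, Num s], Num t]))"
    have "continuous_map (top_of_set (cbox (0, 0) (?Y, ?X))) (Rbr y) (\<lambda>w. Tup [u, Num (fst w)])"
      using u by (auto simp: continuous_map_into_Rbr_iff intro: continuous_intros)
    then have "continuous_map (top_of_set (cbox (0, 0) (?Y, ?X))) (Rbr ?xy) (\<lambda>w. Tup [Tup [u, Num (fst w)], Num (snd w)])"
      using u by (auto simp: continuous_map_into_Rbr_iff[of _ ?xy] intro: continuous_intros)
    from continuous_map_compose[OF this Hom_RnnD(1)[OF f]]
    have cont: "continuous_on (cbox (0, 0) (?Y, ?X)) (\<lambda>(s, t). ?\<phi> s t)"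
      by (simp add: o_def case_prod_unfold)
    have "integral {0..?Y} (\<lambda>s. num (app (Rsum ?xy f) (Tup [u, Num s]))) =
        integral {0..?Y} (\<lambda>s. integral {0..?X} (?\<phi> s))"
      using u by (intro integral_cong) simp
    also have "\<dots> = integral {0..?X} (\<lambda>t. integral {0..?Y} (\<lambda>s. ?\<phi> s t))"
      using integral_swap_continuous[OF cont] by simp
    also have "\<dots> = integral {0..?X} (\<lambda>t. num (app (Rsum ?yx (Comp Top_mtr f (mtr.switch x y))) (Tup [u, Num t])))"
      using u by (intro integral_cong) (auto simp: switch_eq[OF x y] intro!: integral_cong)
    finally show "integral {0..?Y} (\<lambda>s. num (app (Rsum ?xy f) (Tup [u, Num s]))) =
      integral {0..?X} (\<lambda>t. num (app (Rsum ?yx (Comp Top_mtr f (mtr.switch x y))) (Tup [u, Num t])))" .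
  qed
qed

theorem mainTheorem2:
  shows "commutative_dependent_adder
    (Top_mtr :: ('v point topology, 'v map) cat)
    one_space Rnn RF Rp Runit Rbr Rpr Rfib Rsum Rflat"
  by unfold_locales
    (simp_all add: Rsum_in_Hom Rsum_natural Rflat_in_Hom Rflat_over Rsum_right_unit Rsum_left_unit
      Rflat_assoc Rsum_commute, rule Rsum_assoc)

end
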